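(* Let $0<r<1$ and suppose that $M_z$ on $L^2(\beta)$ is a monotonic-$A_r$ weighted shift. Then for every integer $n\ge 2$ the operator $M_{z^n}:L^2(\beta)\to L^2(\beta)$ has exactly $2^n$ reducing subspaces.
   Context: Let $\{\beta(m)\}_{m\in\mathbb{Z}}$ be a two-sided sequence of positive numbers with $\sup_m\lambda_m<\infty$, where $\lambda_m=\beta(m+1)/\beta(m)$. $L^2(\beta)$ is the Hilbert space of two-sided complex sequences $f=\{\hat f(m)\}_{m\in\mathbb{Z}}$, written as formal Laurent series $f(z)=\sum_m\hat f(m)z^m$, with $\|f\|^2=\sum_m|\hat f(m)|^2\beta(m)^2<\infty$ and inner product $(f,g)=\sum_m\hat f(m)\overline{\hat g(m)}\beta(m)^2$. $M_z$ is the bounded operator $(M_zf)(z)=\sum_m\hat f(m)z^{m+1}$ (a bilateral weighted shift with weights $\{\lambda_m\}$), and $(M_{z^n}f)(z)=\sum_m\hat f(m)z^{m+n}$. $M_z$ is called a monotonic-$A_r$ weighted shift if the weights are monotonically increasing ($\lambda_m\le\lambda_{m+1}$ for all $m$), with $\lim_{m\to-\infty}\lambda_m=r$ and $\lim_{m\to\infty}\lambda_m=1$ (so that the spectrum of $M_z$ is the closed annulus $\{r\le|z|\le1\}$). A reducing subspace of an operator $T$ is a closed subspace invariant under both $T$ and $T^*$ (the zero subspace and the whole space are counted). *)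

theory Defs
  imports "HOL-Analysis.Analysis"
begin

definition shift_weight :: "(int \<Rightarrow> real) \<Rightarrow> int \<Rightarrow> real" where
  "shift_weight \<beta> m = \<beta> (m + 1) / \<beta> m"

text \<open>The formal Laurent series with coefficients \<open>f m\<close> is represented by its coefficient
  sequence \<open>f :: int \<Rightarrow> complex\<close>; the space \<open>L\<^sup>2(\<beta>)\<close> is a carrier set of such sequences.\<close>

definition L2 :: "(int \<Rightarrow> real) \<Rightarrow> (int \<Rightarrow> complex) set" where
  "L2 \<beta> = {f. (\<lambda>m. (cmod (f m))\<^sup>2 * (\<beta> m)\<^sup>2) summable_on UNIV}"

definition L2_inner :: "(int \<Rightarrow> real) \<Rightarrow> (int \<Rightarrow> complex) \<Rightarrow> (int \<Rightarrow> complex) \<Rightarrow> complex" where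
  "L2_inner \<beta> f g = (\<Sum>\<^sub>\<infinity>m\<in>UNIV. f m * cnj (g m) * complex_of_real ((\<beta> m)\<^sup>2))"

definition L2_norm :: "(int \<Rightarrow> real) \<Rightarrow> (int \<Rightarrow> complex) \<Rightarrow> real" where
  "L2_norm \<beta> f = sqrt (\<Sum>\<^sub>\<infinity>m\<in>UNIV. (cmod (f m))\<^sup>2 * (\<beta> m)\<^sup>2)"

definition L2_dist :: "(int \<Rightarrow> real) \<Rightarrow> (int \<Rightarrow> complex) \<Rightarrow> (int \<Rightarrow> complex) \<Rightarrow> real" where
  "L2_dist \<beta> f g = L2_norm \<beta> (\<lambda>m. f m - g m)"

lemma L2_norm_sq:
  "(L2_norm \<beta> f)\<^sup>2 = (\<Sum>\<^sub>\<infinity>m\<in>UNIV. (cmod (f m))\<^sup>2 * (\<beta> m)\<^sup>2)"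
  unfolding L2_norm_def by (simp add: infsum_nonneg)

lemma L2_norm_nonneg: "0 \<le> L2_norm \<beta> f"
  unfolding L2_norm_def by (simp add: infsum_nonneg)

lemma L2_finite_le_norm:
  assumes "f \<in> L2 \<beta>" "finite F"
  shows "L2_set (\<lambda>m. cmod (f m) * \<beta> m) F \<le> L2_norm \<beta> f"
  unfolding L2_set_def L2_norm_def power_mult_distrib
  using assms by (intro real_sqrt_le_mono finite_sum_le_infsum) (auto simp: L2_def)

lemma L2_add_aux:
  assumes f: "f \<in> L2 \<beta>" and g: "g \<in> L2 \<beta>" and \<beta>: "\<And>m. \<beta> m > 0"
  shows "(\<lambda>m. f m + g m) \<in> L2 \<beta> \<and> L2_norm \<beta> (\<lambda>m. f m + g m) \<le> L2_norm \<beta> f + L2_norm \<beta> g"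
proof -
  let ?h = "\<lambda>m. f m + g m"
  have fin: "(\<Sum>m\<in>F. (cmod (?h m))\<^sup>2 * (\<beta> m)\<^sup>2) \<le> (L2_norm \<beta> f + L2_norm \<beta> g)\<^sup>2"
    if "finite F" for F
  proof -
    have "L2_set (\<lambda>m. cmod (?h m) * \<beta> m) F
        \<le> L2_set (\<lambda>m. cmod (f m) * \<beta> m + cmod (g m) * \<beta> m) F"
      using \<beta> by (intro L2_set_mono)
        (auto simp: distrib_right[symmetric] less_imp_le intro!: mult_right_mono norm_triangle_ineq)
    also have "\<dots> \<le> L2_set (\<lambda>m. cmod (f m) * \<beta> m) F + L2_set (\<lambda>m. cmod (g m) * \<beta> m) F"
      by (rule L2_set_triangle_ineq)
    also have "\<dots> \<le> L2_norm \<beta> f + L2_norm \<beta> g"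
      using L2_finite_le_norm f g that by (intro add_mono) auto
    finally have "(L2_set (\<lambda>m. cmod (?h m) * \<beta> m) F)\<^sup>2 \<le> (L2_norm \<beta> f + L2_norm \<beta> g)\<^sup>2"
      by (intro power_mono) auto
    then show ?thesis
      by (simp add: L2_set_def power_mult_distrib sum_nonneg)
  qed
  have s: "?h \<in> L2 \<beta>"
    unfolding L2_def mem_Collect_eq
    by (rule nonneg_bdd_above_summable_on) (auto intro!: bdd_aboveI fin)
  then have "(L2_norm \<beta> ?h)\<^sup>2 \<le> (L2_norm \<beta> f + L2_norm \<beta> g)\<^sup>2"
    unfolding L2_norm_sq by (intro infsum_le_finite_sums fin) (auto simp: L2_def)
  then have "L2_norm \<beta> ?h \<le> L2_norm \<beta> f + L2_norm \<beta> g"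
    by (rule power2_le_imp_le) (simp add: L2_norm_nonneg)
  with s show ?thesis by simp
qed

lemma L2_diff:
  assumes "f \<in> L2 \<beta>" "g \<in> L2 \<beta>" "\<And>m. \<beta> m > 0"
  shows "(\<lambda>m. f m - g m) \<in> L2 \<beta>"
proof -
  have "(\<lambda>m. - g m) \<in> L2 \<beta>"
    using assms by (simp add: L2_def)
  from L2_add_aux[OF assms(1) this assms(3)] show ?thesis by simp
qed

lemma Metric_space_L2:
  assumes \<beta>: "\<And>m. \<beta> m > 0"
  shows "Metric_space (L2 \<beta>) (L2_dist \<beta>)"
proof
  fix f g
  show "0 \<le> L2_dist \<beta> f g" by (simp add: L2_dist_def L2_norm_nonneg)
  show "L2_dist \<beta> f g = L2_dist \<beta> g f"
    by (simp add: L2_dist_def L2_norm_def norm_minus_commute)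
next
  fix f g assume fg: "f \<in> L2 \<beta>" "g \<in> L2 \<beta>"
  show "L2_dist \<beta> f g = 0 \<longleftrightarrow> f = g"
  proof
    assume "L2_dist \<beta> f g = 0"
    then have 0: "L2_set (\<lambda>m. cmod (f m - g m) * \<beta> m) {k} \<le> 0" for k
      using L2_finite_le_norm[OF L2_diff[OF fg \<beta>], of "{k}"] by (simp add: L2_dist_def)
    have "f k = g k" for k
      using 0[of k] \<beta>[of k] by (simp add: L2_set_def abs_mult mult_le_0_iff)
    then show "f = g" by auto
  qed (simp add: L2_dist_def L2_norm_def)
next
  fix f g h assume *: "f \<in> L2 \<beta>" "g \<in> L2 \<beta>" "h \<in> L2 \<beta>"
  from L2_add_aux[OF L2_diff[OF *(1,2) \<beta>] L2_diff[OF *(2,3) \<beta>] \<beta>]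
  show "L2_dist \<beta> f h \<le> L2_dist \<beta> f g + L2_dist \<beta> g h"
    by (simp add: L2_dist_def)
qed

definition L2_closed_subspace :: "(int \<Rightarrow> real) \<Rightarrow> (int \<Rightarrow> complex) set \<Rightarrow> bool" where
  "L2_closed_subspace \<beta> N \<longleftrightarrow>
     N \<subseteq> L2 \<beta> \<and> (\<lambda>m. 0) \<in> N \<and>
     (\<forall>f\<in>N. \<forall>g\<in>N. (\<lambda>m. f m + g m) \<in> N) \<and>
     (\<forall>c. \<forall>f\<in>N. (\<lambda>m. c * f m) \<in> N) \<and>
     closedin (Metric_space.mtopology (L2 \<beta>) (L2_dist \<beta>)) N"

text \<open>The defining identity \<open>(T f, g) = (f, T\<^sup>* g)\<close>; for \<open>T\<close> bounded on \<open>L2 \<beta>\<close> and \<open>g \<in> L2 \<beta>\<close>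
  such an element exists and is unique. Values at \<open>g \<notin> L2 \<beta>\<close> carry no meaning.\<close>

definition L2_adjoint ::
  "(int \<Rightarrow> real) \<Rightarrow> ((int \<Rightarrow> complex) \<Rightarrow> (int \<Rightarrow> complex)) \<Rightarrow> (int \<Rightarrow> complex) \<Rightarrow> (int \<Rightarrow> complex)" where
  "L2_adjoint \<beta> T g = (THE h. h \<in> L2 \<beta> \<and> (\<forall>f\<in>L2 \<beta>. L2_inner \<beta> (T f) g = L2_inner \<beta> f h))"

definition reducing_subspace ::
  "(int \<Rightarrow> real) \<Rightarrow> ((int \<Rightarrow> complex) \<Rightarrow> (int \<Rightarrow> complex)) \<Rightarrow> (int \<Rightarrow> complex) set \<Rightarrow> bool" where
  "reducing_subspace \<beta> T N \<longleftrightarrow>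
     L2_closed_subspace \<beta> N \<and> T ` N \<subseteq> N \<and> L2_adjoint \<beta> T ` N \<subseteq> N"

text \<open>Multiplication by \<open>z\<^sup>n\<close>: the coefficient of \<open>z\<^sup>m\<close> in \<open>z\<^sup>n f(z)\<close> is \<open>f (m - n)\<close>.\<close>

definition mult_z_power :: "nat \<Rightarrow> (int \<Rightarrow> complex) \<Rightarrow> (int \<Rightarrow> complex)" where
  "mult_z_power n f = (\<lambda>m. f (m - int n))"

definition monotonic_A_shift :: "real \<Rightarrow> (int \<Rightarrow> real) \<Rightarrow> bool" where
  "monotonic_A_shift r \<beta> \<longleftrightarrow>
     (\<forall>m. shift_weight \<beta> m \<le> shift_weight \<beta> (m + 1)) \<and>
     (shift_weight \<beta> \<longlongrightarrow> r) at_bot \<and>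
     (shift_weight \<beta> \<longlongrightarrow> 1) at_top"

end

theory Submission
  imports Defs
begin

text \<open>
  Write \<open>T = M_{z^n}\<close>. The span of the monomials \<open>z\<^sup>m\<close> with \<open>m\<close> in a fixed union of residue classes
  modulo \<open>n\<close> has a closure that reduces \<open>T\<close>, and there are \<open>2\<^sup>n\<close> such unions. What has to be proved
  is that every reducing subspace \<open>N\<close> is of this kind.

  The operators \<open>T\<^sup>*\<^sup>k T\<^sup>k\<close> and \<open>T\<^sup>k T\<^sup>*\<^sup>k\<close> map \<open>N\<close> into itself and are diagonal, with the entries
  \<open>(\<beta>(m + kn) / \<beta>(m))\<^sup>2\<close> and \<open>(\<beta>(m) / \<beta>(m - kn))\<^sup>2\<close>. The weights increase to 1, so \<open>\<beta>\<close> decreases and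
  all these entries lie in \<open>(0, 1]\<close>.

  The entries tell the indices apart (\<open>ratios_separate_coordinates\<close>). Suppose that all of them agree
  at \<open>i\<close> and at \<open>i + d\<close> with \<open>d > 0\<close>. Then \<open>g(m) = \<beta>(m + d) / \<beta>(m)\<close>, a product of \<open>d\<close> consecutive
  weights, takes the value \<open>g(i)\<close> along the whole progression \<open>i + n\<int>\<close>. But \<open>g\<close> tends to 1 at
  \<open>\<infinity>\<close> and to \<open>r\<^sup>d < 1\<close> at \<open>-\<infinity>\<close>.

  The bounded real diagonal operators that leave \<open>N\<close> invariant are closed under products, linear
  combinations and, because \<open>N\<close> is closed, under bounded pointwise limits of their entries
  (\<open>L2_closed_subspace_bounded_multiplier_limit\<close>). A separating family of entries therefore produces
  the projection onto each single coordinate (\<open>coordinate_projection_mem\<close>). So \<open>N\<close> contains \<open>z\<^sup>i\<close>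
  as soon as some member of \<open>N\<close> has a nonzero coefficient at \<open>i\<close>, and \<open>N\<close> is the closed span of the
  monomials in it; invariance under \<open>T\<close> and \<open>T\<^sup>*\<close> makes the set of their exponents periodic modulo
  \<open>n\<close>. Arguing with the elements of \<open>N\<close> in this way avoids the orthogonal projection onto \<open>N\<close>, and
  with it any appeal to completeness of \<open>L\<^sup>2(\<beta>)\<close>.
\<close>

section \<open>Weighted square-summable sequences\<close>

definition coordinate_vector :: "int \<Rightarrow> int \<Rightarrow> complex" where
  "coordinate_vector i = (\<lambda>m. if m = i then 1 else 0)"

lemma coordinate_vector_in_L2: "coordinate_vector i \<in> L2 \<beta>"
proof -
  have "(\<lambda>m. (cmod (coordinate_vector i m))\<^sup>2 * (\<beta> m)\<^sup>2) summable_on UNIV \<longleftrightarrow>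
        (\<lambda>m. (cmod (coordinate_vector i m))\<^sup>2 * (\<beta> m)\<^sup>2) summable_on {i}"
    by (rule summable_on_cong_neutral) (auto simp: coordinate_vector_def)
  then show ?thesis
    by (simp add: L2_def)
qed

lemma L2_inner_coordinate_vector:
  "L2_inner \<beta> (coordinate_vector i) h = cnj (h i) * complex_of_real ((\<beta> i)\<^sup>2)"
proof -
  have "L2_inner \<beta> (coordinate_vector i) h =
    (\<Sum>\<^sub>\<infinity>m\<in>{i}. coordinate_vector i m * cnj (h m) * complex_of_real ((\<beta> m)\<^sup>2))"
    unfolding L2_inner_def
    by (rule infsum_cong_neutral) (auto simp: coordinate_vector_def)
  then show ?thesis
    by (simp add: coordinate_vector_def)
qed

lemma L2_comparison:
  assumes "g \<in> L2 \<beta>" and "\<And>m. cmod (f m) \<le> cmod (g m)"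
  shows "f \<in> L2 \<beta>"
  unfolding L2_def mem_Collect_eq
  by (rule summable_on_comparison_test[OF assms(1)[unfolded L2_def mem_Collect_eq]])
     (auto intro!: mult_right_mono power_mono assms(2))

lemma L2_scale:
  assumes "f \<in> L2 \<beta>"
  shows "(\<lambda>m. c * f m) \<in> L2 \<beta>"
proof -
  have "(\<lambda>m. (cmod c)\<^sup>2 * ((cmod (f m))\<^sup>2 * (\<beta> m)\<^sup>2)) summable_on UNIV"
    using assms unfolding L2_def by (intro summable_on_cmult_right) auto
  then show ?thesis
    by (simp add: L2_def norm_mult power_mult_distrib mult.assoc)
qed

text \<open>The squared norm of the difference is a sum dominated termwise by four times the sum for
  \<open>\<parallel>f\<parallel>\<^sup>2\<close>, so dominated convergence for the counting measure applies.\<close>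

lemma L2_dist_bounded_multiplier_tendsto_0:
  fixes a :: "nat \<Rightarrow> int \<Rightarrow> real" and b :: "int \<Rightarrow> real" and f :: "int \<Rightarrow> complex"
  assumes f: "f \<in> L2 \<beta>"
    and bound: "\<And>j m. \<bar>a j m\<bar> \<le> 1"
    and lim: "\<And>m. (\<lambda>j. a j m) \<longlonglongrightarrow> b m"
  shows "(\<lambda>j. L2_dist \<beta> (\<lambda>m. a j m * f m) (\<lambda>m. b m * f m)) \<longlonglongrightarrow> 0"
proof -
  define s where "s j m = (cmod (a j m * f m - b m * f m))\<^sup>2 * (\<beta> m)\<^sup>2" for j m
  define w where "w m = 4 * ((cmod (f m))\<^sup>2 * (\<beta> m)\<^sup>2)" for m
  have "(\<lambda>m. 4 * ((cmod (f m))\<^sup>2 * (\<beta> m)\<^sup>2)) summable_on UNIV"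
    using f unfolding L2_def by (intro summable_on_cmult_right) auto
  then have "(\<lambda>m. norm (w m)) summable_on UNIV"
    by (simp add: w_def)
  then have w: "integrable (count_space UNIV) w"
    unfolding abs_summable_equivalent abs_summable_on_def .
  have b: "\<bar>b m\<bar> \<le> 1" for m
    using lim[of m] bound[of _ m] by (intro tendsto_upperbound[OF tendsto_rabs]) auto
  have s_le: "norm (s j m) \<le> w m" for j m
  proof -
    have "\<bar>a j m - b m\<bar> \<le> 2"
      using b[of m] bound[of j m] by linarith
    then have "cmod (a j m * f m - b m * f m) \<le> 2 * cmod (f m)"
      unfolding left_diff_distrib[symmetric] norm_mult
      by (intro mult_right_mono) (simp_all flip: of_real_diff)
    then have "(cmod (a j m * f m - b m * f m))\<^sup>2 \<le> 4 * (cmod (f m))\<^sup>2"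
      using power_mono[of _ "2 * cmod (f m)" 2] by (fastforce simp: power_mult_distrib)
    then show ?thesis
      unfolding s_def w_def
      by (simp add: mult_right_mono flip: mult.assoc)
  qed
  have int: "integrable (count_space UNIV) (s j)" for j
    by (rule Bochner_Integration.integrable_bound[OF w])
       (simp, rule AE_I2, rule order_trans[OF s_le], simp)
  have s0: "(\<lambda>j. s j m) \<longlonglongrightarrow> 0" for m
  proof -
    have "(\<lambda>j. s j m) \<longlonglongrightarrow> (cmod (b m * f m - b m * f m))\<^sup>2 * (\<beta> m)\<^sup>2"
      unfolding s_def by (intro tendsto_intros lim)
    then show ?thesis by simp
  qed
  have "(\<lambda>j. integral\<^sup>L (count_space UNIV) (s j)) \<longlonglongrightarrow> integral\<^sup>L (count_space UNIV) (\<lambda>_::int. 0::real)"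
    by (rule integral_dominated_convergence[OF _ _ w]) (auto intro!: AE_I2 s0 s_le[unfolded real_norm_def])
  moreover have "integral\<^sup>L (count_space UNIV) (s j) = infsum (s j) UNIV" for j
    using infsetsum_infsum[of "s j" UNIV] int[of j]
    by (simp add: infsetsum_def abs_summable_on_def)
  ultimately have "(\<lambda>j. sqrt (infsum (s j) UNIV)) \<longlonglongrightarrow> sqrt 0"
    by (intro tendsto_real_sqrt) simp
  then show ?thesis
    by (simp add: L2_dist_def L2_norm_def s_def[abs_def])
qed

lemma L2_closed_subspace_bounded_multiplier_limit:
  fixes a :: "nat \<Rightarrow> int \<Rightarrow> real" and b :: "int \<Rightarrow> real" and f :: "int \<Rightarrow> complex"
  assumes pos: "\<And>m. \<beta> m > 0"
    and N: "L2_closed_subspace \<beta> N"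
    and f: "f \<in> L2 \<beta>"
    and mem: "\<And>j. (\<lambda>m. a j m * f m) \<in> N"
    and bound: "\<And>j m. \<bar>a j m\<bar> \<le> 1"
    and lim: "\<And>m. (\<lambda>j. a j m) \<longlonglongrightarrow> b m"
  shows "(\<lambda>m. b m * f m) \<in> N"
proof -
  interpret M: Metric_space "L2 \<beta>" "L2_dist \<beta>"
    by (rule Metric_space_L2[OF pos])
  have NL: "N \<subseteq> L2 \<beta>" and cl: "closedin M.mtopology N"
    using N by (auto simp: L2_closed_subspace_def)
  have b: "\<bar>b m\<bar> \<le> 1" for m
    using lim[of m] bound[of _ m] by (intro tendsto_upperbound[OF tendsto_rabs]) auto
  have "(\<lambda>m. b m * f m) \<in> L2 \<beta>"
    by (rule L2_comparison[OF f]) (simp add: norm_mult b mult_left_le_one_le)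
  then have "limitin M.mtopology (\<lambda>j m. a j m * f m) (\<lambda>m. b m * f m) sequentially"
    unfolding M.limitin_metric_dist_null
    by (intro conjI always_eventually allI subsetD[OF NL mem]
        L2_dist_bounded_multiplier_tendsto_0[OF f bound lim])
  moreover have "range (\<lambda>j m. a j m * f m) \<subseteq> N"
    using mem by (rule image_subsetI)
  ultimately show ?thesis
    using cl unfolding M.metric_closedin_iff_sequentially_closed by blast
qed

section \<open>Diagonal operators leaving a subspace invariant\<close>

definition preserves :: "(int \<Rightarrow> complex) set \<Rightarrow> (int \<Rightarrow> real) \<Rightarrow> bool" where
  "preserves N a \<longleftrightarrow> (\<forall>f\<in>N. (\<lambda>m. complex_of_real (a m) * f m) \<in> N)"

lemma preserves_mult:
  assumes "preserves N a" "preserves N b"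
  shows "preserves N (\<lambda>m. a m * b m)"
  using assms by (force simp: preserves_def mult.assoc)

lemma preserves_one: "preserves N (\<lambda>m. 1)"
  by (simp add: preserves_def)

lemma preserves_power: "preserves N a \<Longrightarrow> preserves N (\<lambda>m. a m ^ k)"
  by (induction k) (auto intro: preserves_mult preserves_one)

lemma preserves_prod:
  assumes "finite K" "\<And>k. k \<in> K \<Longrightarrow> preserves N (a k)"
  shows "preserves N (\<lambda>m. \<Prod>k\<in>K. a k m)"
  using assms by (induction K) (auto intro: preserves_mult preserves_one)

lemma preserves_add_scaled:
  assumes N: "L2_closed_subspace \<beta> N" and "preserves N a" "preserves N b"
  shows "preserves N (\<lambda>m. a m + c * b m)"
  unfolding preserves_def
proof
  fix f assume "f \<in> N"
  then have a: "(\<lambda>m. a m * f m) \<in> N" and b: "(\<lambda>m. b m * f m) \<in> N"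
    using assms by (auto simp: preserves_def)
  have add: "\<And>g h. g \<in> N \<Longrightarrow> h \<in> N \<Longrightarrow> (\<lambda>m. g m + h m) \<in> N"
    and scale: "\<And>d g. g \<in> N \<Longrightarrow> (\<lambda>m. d * g m) \<in> N"
    using N by (auto simp: L2_closed_subspace_def)
  show "(\<lambda>m. complex_of_real (a m + c * b m) * f m) \<in> N"
    using add[OF a scale[OF b, of "complex_of_real c"]]
    by (simp add: distrib_right mult.assoc)
qed

text \<open>For \<open>c\<close> and \<open>x\<close> in \<open>(0, 1]\<close> the value \<open>peak c x\<close> lies in \<open>[0, 1]\<close> and equals 1 only at \<open>x = c\<close>.
  Its powers converge boundedly to the indicator of \<open>{c}\<close>, and being a polynomial in \<open>x\<close> it can be
  applied to the entries of a diagonal operator.\<close>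

definition peak :: "real \<Rightarrow> real \<Rightarrow> real" where
  "peak c x = 1 - (x - c)\<^sup>2"

lemma preserves_peak:
  assumes N: "L2_closed_subspace \<beta> N" and a: "preserves N a"
  shows "preserves N (\<lambda>m. peak c (a m))"
proof -
  have "preserves N (\<lambda>m. a m + (- c) * 1)"
    by (rule preserves_add_scaled[OF N a preserves_one])
  then have "preserves N (\<lambda>m. 1 + (- 1) * (a m + (- c) * 1) ^ 2)"
    by (rule preserves_add_scaled[OF N preserves_one preserves_power])
  then show ?thesis
    by (simp add: peak_def)
qed

lemma peak_bounds:
  assumes "0 < c" "c \<le> 1" "0 < x" "x \<le> 1"
  shows "0 \<le> peak c x" "peak c x \<le> 1"
proof -
  have "\<bar>x - c\<bar> \<le> 1" using assms by linarith
  then show "0 \<le> peak c x" "peak c x \<le> 1"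
    by (simp_all add: peak_def abs_square_le_1)
qed

lemma peak_self [simp]: "peak c c = 1"
  by (simp add: peak_def)

lemma peak_less_1: "x \<noteq> c \<Longrightarrow> peak c x < 1"
  by (simp add: peak_def)

text \<open>The product of the peaks at \<open>a k i\<close> over all \<open>k < J\<close>, raised to the power \<open>J\<close>, stays in \<open>[0, 1]\<close>
  and equals 1 at the index \<open>i\<close>. At any other index one factor is some \<open>q < 1\<close>, present for all large
  \<open>J\<close>, and the value is at most \<open>q^J\<close>. Hence the limit is the indicator of \<open>{i}\<close>. A single limit
  suffices because the exponent grows together with the number of factors.\<close>

lemma coordinate_projection_mem:
  fixes a :: "nat \<Rightarrow> int \<Rightarrow> real"
  assumes pos: "\<And>m. \<beta> m > 0"
    and N: "L2_closed_subspace \<beta> N"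
    and pres: "\<And>k. preserves N (a k)"
    and range: "\<And>k m. 0 < a k m \<and> a k m \<le> 1"
    and sep: "\<And>m. m \<noteq> i \<Longrightarrow> \<exists>k. a k m \<noteq> a k i"
    and f: "f \<in> N"
  shows "(\<lambda>m. f i * coordinate_vector i m) \<in> N"
proof -
  define b where "b J m = (\<Prod>k<J. peak (a k i) (a k m)) ^ J" for J m
  define \<delta> :: "int \<Rightarrow> real" where "\<delta> m = (if m = i then 1 else 0)" for m
  have peak01: "0 \<le> peak (a k i) (a k m)" "peak (a k i) (a k m) \<le> 1" for k m
    using range by (auto intro!: peak_bounds)
  have prod01: "0 \<le> (\<Prod>k<J. peak (a k i) (a k m))" "(\<Prod>k<J. peak (a k i) (a k m)) \<le> 1" for J m
    by (auto intro!: prod_nonneg prod_le_1 peak01)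
  have "\<bar>b J m\<bar> \<le> 1" for J m
    using prod01[where J = J and m = m] by (simp add: b_def power_le_one)
  moreover have "(\<lambda>J. b J m) \<longlonglongrightarrow> \<delta> m" for m
  proof (cases "m = i")
    case True
    then show ?thesis by (simp add: b_def \<delta>_def)
  next
    case False
    then obtain k where "a k m \<noteq> a k i" using sep by blast
    define q where "q = peak (a k i) (a k m)"
    have q: "0 \<le> q" "q < 1"
      using peak01 peak_less_1[OF \<open>a k m \<noteq> a k i\<close>] by (auto simp: q_def)
    have b_le: "norm (b J m) \<le> q ^ J" if "J > k" for J
    proof -
      have "(\<Prod>l<J. peak (a l i) (a l m)) = q * (\<Prod>l\<in>{..<J} - {k}. peak (a l i) (a l m))"
        unfolding q_def using that by (intro prod.remove) auto
      also have "\<dots> \<le> q * 1"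
        by (intro mult_left_mono prod_le_1 conjI peak01 q(1))
      finally show ?thesis
        using prod01[where J = J and m = m] by (simp add: b_def power_mono)
    qed
    have ev: "eventually (\<lambda>J. norm (b J m) \<le> q ^ J) sequentially"
      using eventually_gt_at_top[of k] by eventually_elim (rule b_le)
    have "(\<lambda>J. b J m) \<longlonglongrightarrow> 0"
      by (rule Lim_null_comparison[OF ev]) (rule LIMSEQ_realpow_zero[OF q])
    with False show ?thesis by (simp add: \<delta>_def)
  qed
  moreover have "preserves N (b J)" for J
    unfolding b_def by (intro preserves_power preserves_prod preserves_peak[OF N] pres) auto
  moreover have "f \<in> L2 \<beta>"
    using N f by (auto simp: L2_closed_subspace_def)
  ultimately have "(\<lambda>m. \<delta> m * f m) \<in> N"
    using L2_closed_subspace_bounded_multiplier_limit[OF pos N, of f b \<delta>] f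
    unfolding preserves_def by blast
  moreover have "(\<lambda>m. \<delta> m * f m) = (\<lambda>m. f i * coordinate_vector i m)"
    by (auto simp: \<delta>_def coordinate_vector_def)
  ultimately show ?thesis by simp
qed

section \<open>Powers of a contractive weighted shift\<close>

text \<open>The explicit form of the adjoint of multiplication by \<open>z^n\<close>.\<close>

definition backward_shift :: "(int \<Rightarrow> real) \<Rightarrow> nat \<Rightarrow> (int \<Rightarrow> complex) \<Rightarrow> int \<Rightarrow> complex" where
  "backward_shift \<beta> n g = (\<lambda>m. complex_of_real ((\<beta> (m + int n) / \<beta> m)\<^sup>2) * g (m + int n))"

locale decreasing_weight =
  fixes \<beta> :: "int \<Rightarrow> real"
  assumes pos: "\<beta> m > 0"
    and step: "\<beta> (m + 1) \<le> \<beta> m"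
begin

lemma decreasing: "\<beta> (m + int k) \<le> \<beta> m"
proof (induction k)
  case (Suc k)
  then show ?case
    using step[of "m + int k"] by (simp add: add_ac)
qed simp

lemma ratio_bounds: "0 < (\<beta> (m + int k) / \<beta> m)\<^sup>2" "(\<beta> (m + int k) / \<beta> m)\<^sup>2 \<le> 1"
  using pos[of m] pos[of "m + int k"] decreasing[of m k]
  by (auto simp: power_le_one)

lemma mult_z_power_in_L2:
  assumes "f \<in> L2 \<beta>"
  shows "mult_z_power n f \<in> L2 \<beta>"
proof -
  have "(\<lambda>m. (cmod (f m))\<^sup>2 * (\<beta> m)\<^sup>2) summable_on UNIV"
    using assms by (simp add: L2_def)
  then have "(\<lambda>m. (cmod (f m))\<^sup>2 * (\<beta> (m + int n))\<^sup>2) summable_on UNIV"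
    by (rule summable_on_comparison_test)
       (auto intro!: mult_left_mono power_mono decreasing less_imp_le[OF pos])
  then have "(\<lambda>m. (cmod (f (m - int n)))\<^sup>2 * (\<beta> (m - int n + int n))\<^sup>2) summable_on UNIV"
    by (subst summable_on_reindex_bij_betw[of "\<lambda>m. m - int n" UNIV UNIV])
       (auto intro!: bij_betwI[of _ _ _ "\<lambda>m. m + int n"])
  then show ?thesis
    by (simp add: L2_def mult_z_power_def)
qed

lemma backward_shift_in_L2:
  assumes "g \<in> L2 \<beta>"
  shows "backward_shift \<beta> n g \<in> L2 \<beta>"
proof -
  have "(\<lambda>m. (cmod (g m))\<^sup>2 * (\<beta> m)\<^sup>2) summable_on UNIV"
    using assms by (simp add: L2_def)
  then have s: "(\<lambda>m. (cmod (g (m + int n)))\<^sup>2 * (\<beta> (m + int n))\<^sup>2) summable_on UNIV"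
    by (subst summable_on_reindex_bij_betw[of "\<lambda>m. m + int n" UNIV UNIV])
       (auto intro!: bij_betwI[of _ _ _ "\<lambda>m. m - int n"])
  show ?thesis
    unfolding L2_def mem_Collect_eq
  proof (rule summable_on_comparison_test[OF s])
    fix m :: int
    define q where "q = (\<beta> (m + int n) / \<beta> m)\<^sup>2"
    have q: "0 < q" "q \<le> 1"
      using ratio_bounds[of m n] by (auto simp: q_def)
    have "(cmod (backward_shift \<beta> n g m))\<^sup>2 * (\<beta> m)\<^sup>2 = q * ((cmod (g (m + int n)))\<^sup>2 * (q * (\<beta> m)\<^sup>2))"
      unfolding backward_shift_def q_def[symmetric] using q
      by (simp add: norm_mult power_mult_distrib power2_eq_square)
    also have "q * (\<beta> m)\<^sup>2 = (\<beta> (m + int n))\<^sup>2"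
      using pos[of m] by (simp add: q_def power_divide)
    also have "q * ((cmod (g (m + int n)))\<^sup>2 * (\<beta> (m + int n))\<^sup>2)
        \<le> (cmod (g (m + int n)))\<^sup>2 * (\<beta> (m + int n))\<^sup>2"
      using q by (intro mult_left_le_one_le) auto
    finally show "(cmod (backward_shift \<beta> n g m))\<^sup>2 * (\<beta> m)\<^sup>2 \<le> \<dots>" .
  qed auto
qed

text \<open>The adjoint identity is the substitution \<open>m \<mapsto> m + n\<close> in the sum that defines the inner product;
  testing against monomials gives uniqueness.\<close>

lemma L2_adjoint_mult_z_power:
  assumes "g \<in> L2 \<beta>"
  shows "L2_adjoint \<beta> (mult_z_power n) g = backward_shift \<beta> n g"
  unfolding L2_adjoint_def
proof (rule the_equality)
  have eq: "L2_inner \<beta> (mult_z_power n f) g = L2_inner \<beta> f (backward_shift \<beta> n g)" for f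
  proof -
    have "L2_inner \<beta> (mult_z_power n f) g =
      (\<Sum>\<^sub>\<infinity>m\<in>UNIV. f (m + int n - int n) * cnj (g (m + int n)) * complex_of_real ((\<beta> (m + int n))\<^sup>2))"
      unfolding L2_inner_def mult_z_power_def
      by (rule infsum_reindex_bij_betw[of "\<lambda>m. m + int n" UNIV UNIV, symmetric])
         (auto intro!: bij_betwI[of _ _ _ "\<lambda>m. m - int n"])
    also have "\<dots> = L2_inner \<beta> f (backward_shift \<beta> n g)"
      unfolding L2_inner_def backward_shift_def
      using pos by (intro infsum_cong) (simp add: power_divide less_imp_neq[THEN not_sym])
    finally show ?thesis .
  qed
  show adj: "backward_shift \<beta> n g \<in> L2 \<beta> \<and>
    (\<forall>f\<in>L2 \<beta>. L2_inner \<beta> (mult_z_power n f) g = L2_inner \<beta> f (backward_shift \<beta> n g))"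
    using eq backward_shift_in_L2[OF assms] by blast
  fix h
  assume h: "h \<in> L2 \<beta> \<and> (\<forall>f\<in>L2 \<beta>. L2_inner \<beta> (mult_z_power n f) g = L2_inner \<beta> f h)"
  have "h i = backward_shift \<beta> n g i" for i
  proof -
    have "L2_inner \<beta> (coordinate_vector i) h = L2_inner \<beta> (coordinate_vector i) (backward_shift \<beta> n g)"
      using h adj coordinate_vector_in_L2 by metis
    then show ?thesis
      using pos[of i] by (simp add: L2_inner_coordinate_vector)
  qed
  then show "h = backward_shift \<beta> n g" by auto
qed

lemma mult_z_power_add: "mult_z_power n (mult_z_power k f) = mult_z_power (n + k) f"
  by (auto simp: mult_z_power_def algebra_simps)

lemma backward_shift_add: "backward_shift \<beta> n (backward_shift \<beta> k f) = backward_shift \<beta> (n + k) f"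
proof
  fix m
  have "\<beta> (m + int n) \<noteq> 0" "\<beta> m \<noteq> 0"
    using pos[of "m + int n"] pos[of m] by auto
  then show "backward_shift \<beta> n (backward_shift \<beta> k f) m = backward_shift \<beta> (n + k) f m"
    by (simp add: backward_shift_def power_divide add_ac)
qed

text \<open>The next two identities are the reason why multipliers enter: both compositions of a shift with
  its adjoint are diagonal.\<close>

lemma backward_shift_mult_z_power:
  "backward_shift \<beta> k (mult_z_power k f) = (\<lambda>m. complex_of_real ((\<beta> (m + int k) / \<beta> m)\<^sup>2) * f m)"
  by (simp add: backward_shift_def mult_z_power_def)

lemma mult_z_power_backward_shift:
  "mult_z_power k (backward_shift \<beta> k f) = (\<lambda>m. complex_of_real ((\<beta> m / \<beta> (m - int k))\<^sup>2) * f m)"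
  by (simp add: backward_shift_def mult_z_power_def)

lemma mult_z_power_coordinate_vector:
  "mult_z_power k (coordinate_vector i) = coordinate_vector (i + int k)"
  by (auto simp: mult_z_power_def coordinate_vector_def)

lemma backward_shift_coordinate_vector:
  "backward_shift \<beta> k (coordinate_vector i) =
    (\<lambda>m. complex_of_real ((\<beta> i / \<beta> (i - int k))\<^sup>2) * coordinate_vector (i - int k) m)"
  by (auto simp: backward_shift_def coordinate_vector_def)

section \<open>Subspaces spanned by residue classes of monomials\<close>

definition residue_subspace :: "nat \<Rightarrow> int set \<Rightarrow> (int \<Rightarrow> complex) set" where
  "residue_subspace n R = {f \<in> L2 \<beta>. \<forall>m. m mod int n \<notin> R \<longrightarrow> f m = 0}"

lemma coordinate_vector_in_residue_subspace:
  "coordinate_vector i \<in> residue_subspace n R \<longleftrightarrow> i mod int n \<in> R"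
  by (simp add: residue_subspace_def coordinate_vector_in_L2) (auto simp: coordinate_vector_def)

lemma inj_on_residue_subspace: "inj_on (residue_subspace n) (Pow {0..<int n})"
proof (rule inj_onI)
  fix R S assume R: "R \<in> Pow {0..<int n}" and S: "S \<in> Pow {0..<int n}"
    and eq: "residue_subspace n R = residue_subspace n S"
  have "i \<in> R \<longleftrightarrow> i \<in> S" if "i \<in> {0..<int n}" for i
    using coordinate_vector_in_residue_subspace[of i n R]
      coordinate_vector_in_residue_subspace[of i n S] eq that by simp
  then show "R = S" using R S by blast
qed

text \<open>Closedness holds because each coefficient is bounded by a multiple of the norm, so a vanishing
  coefficient persists in the limit.\<close>

lemma residue_subspace_closed: "L2_closed_subspace \<beta> (residue_subspace n R)"
proof -
  interpret M: Metric_space "L2 \<beta>" "L2_dist \<beta>"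
    by (rule Metric_space_L2[OF pos])
  have "closedin M.mtopology (residue_subspace n R)"
    unfolding M.metric_closedin_iff_sequentially_closed
  proof (intro conjI allI impI)
    show "residue_subspace n R \<subseteq> L2 \<beta>" by (auto simp: residue_subspace_def)
    fix \<sigma> :: "nat \<Rightarrow> int \<Rightarrow> complex" and l
    assume *: "range \<sigma> \<subseteq> residue_subspace n R \<and> limitin M.mtopology \<sigma> l sequentially"
    then have l: "l \<in> L2 \<beta>" and lim: "(\<lambda>j. L2_dist \<beta> (\<sigma> j) l) \<longlonglongrightarrow> 0"
      by (auto simp: M.limitin_metric_dist_null)
    have \<sigma>: "\<sigma> j \<in> L2 \<beta>" "m mod int n \<notin> R \<Longrightarrow> \<sigma> j m = 0" for j m
      using * by (auto simp: residue_subspace_def)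
    have "l m = 0" if "m mod int n \<notin> R" for m
    proof -
      have "cmod (l m) * \<beta> m \<le> L2_dist \<beta> (\<sigma> j) l" for j
        using L2_finite_le_norm[OF L2_diff[OF \<sigma>(1) l pos], of "{m}" j] \<sigma>(2)[OF that] pos[of m]
        by (simp add: L2_dist_def L2_set_def abs_mult)
      then have "cmod (l m) * \<beta> m \<le> 0"
        by (intro tendsto_lowerbound[OF lim]) auto
      then show ?thesis
        using pos[of m] by (simp add: mult_le_0_iff)
    qed
    with l show "l \<in> residue_subspace n R" by (simp add: residue_subspace_def)
  qed
  moreover have "(\<lambda>m. 0) \<in> L2 \<beta>" by (simp add: L2_def)
  ultimately show ?thesis
    using L2_add_aux[OF _ _ pos] L2_scale
    by (auto simp: L2_closed_subspace_def residue_subspace_def)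
qed

lemma residue_subspace_reducing:
  "reducing_subspace \<beta> (mult_z_power n) (residue_subspace n R)"
  unfolding reducing_subspace_def
proof (intro conjI image_subsetI)
  show "L2_closed_subspace \<beta> (residue_subspace n R)"
    by (rule residue_subspace_closed)
next
  fix f assume "f \<in> residue_subspace n R"
  then have f: "f \<in> L2 \<beta>" "\<And>m. m mod int n \<notin> R \<Longrightarrow> f m = 0"
    by (auto simp: residue_subspace_def)
  show "mult_z_power n f \<in> residue_subspace n R"
    using mult_z_power_in_L2[OF f(1)] f(2) by (simp add: residue_subspace_def mult_z_power_def)
  show "L2_adjoint \<beta> (mult_z_power n) f \<in> residue_subspace n R"
    using backward_shift_in_L2[OF f(1)] f(2)
    by (simp add: L2_adjoint_mult_z_power[OF f(1)] residue_subspace_def backward_shift_def)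
qed

text \<open>The series \<open>f\<close> is the norm limit of its truncations, which are finite combinations of the given
  monomials; truncation is multiplication by an indicator, so the limit is again that of bounded
  multipliers.\<close>

lemma closed_subspace_mem_by_coordinates:
  assumes N: "L2_closed_subspace \<beta> N" and f: "f \<in> L2 \<beta>"
    and mem: "\<And>i. f i \<noteq> 0 \<Longrightarrow> coordinate_vector i \<in> N"
  shows "f \<in> N"
proof -
  have scale: "(\<lambda>m. c * g m) \<in> N" if "g \<in> N" for c g
    using N that by (auto simp: L2_closed_subspace_def)
  have add: "(\<lambda>m. g m + h m) \<in> N" if "g \<in> N" "h \<in> N" for g h
    using N that by (auto simp: L2_closed_subspace_def)
  have zero: "(\<lambda>m. 0) \<in> N"
    using N by (auto simp: L2_closed_subspace_def)
  have coord: "(\<lambda>m. f i * coordinate_vector i m) \<in> N" for i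
    using scale[OF mem] zero by (cases "f i = 0") auto
  have sum: "(\<lambda>m. \<Sum>i\<in>F. f i * coordinate_vector i m) \<in> N" if "finite F" for F
    using that by (induction F) (auto intro: zero add coord)
  define a :: "nat \<Rightarrow> int \<Rightarrow> real" where "a J m = (if m \<in> {-int J..int J} then 1 else 0)" for J m
  have "(\<lambda>m. a J m * f m) \<in> N" for J
  proof -
    have "(\<lambda>m. a J m * f m) = (\<lambda>m. \<Sum>i\<in>{-int J..int J}. f i * coordinate_vector i m)"
      by (rule ext) (auto simp: a_def coordinate_vector_def if_distrib cong: if_cong)
    then show ?thesis using sum[of "{-int J..int J}"] by simp
  qed
  moreover have "(\<lambda>J. a J m) \<longlonglongrightarrow> 1" for m
  proof -
    have "eventually (\<lambda>J. a J m = 1) sequentially"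
      using eventually_ge_at_top[of "nat \<bar>m\<bar>"] by eventually_elim (auto simp: a_def)
    then show ?thesis by (rule tendsto_eventually)
  qed
  ultimately have "(\<lambda>m. complex_of_real 1 * f m) \<in> N"
    using L2_closed_subspace_bounded_multiplier_limit[OF pos N f, of a "\<lambda>_. 1"]
    by (auto simp: a_def)
  then show ?thesis by simp
qed

section \<open>Reducing subspaces are spanned by monomials\<close>

lemma reducing_invariant_powers:
  assumes N: "reducing_subspace \<beta> (mult_z_power n) N" and f: "f \<in> N"
  shows "mult_z_power (k * n) f \<in> N" and "backward_shift \<beta> (k * n) f \<in> N"
proof -
  have T: "mult_z_power n g \<in> N" if "g \<in> N" for g
    using N that by (auto simp: reducing_subspace_def)
  have T': "backward_shift \<beta> n g \<in> N" if "g \<in> N" for g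
  proof -
    have "g \<in> L2 \<beta>"
      using N that by (auto simp: reducing_subspace_def L2_closed_subspace_def)
    then show ?thesis
      using N that L2_adjoint_mult_z_power[of g n] unfolding reducing_subspace_def by force
  qed
  show "mult_z_power (k * n) f \<in> N"
  proof (induction k)
    case 0 show ?case using f by (simp add: mult_z_power_def)
  next
    case (Suc k) then show ?case using T[OF Suc] by (simp add: mult_z_power_add)
  qed
  show "backward_shift \<beta> (k * n) f \<in> N"
  proof (induction k)
    case 0 show ?case
      using f pos by (simp add: backward_shift_def less_imp_neq[THEN not_sym])
  next
    case (Suc k) then show ?case using T'[OF Suc] by (simp add: backward_shift_add)
  qed
qed

lemma reducing_preserves_ratios:
  assumes "reducing_subspace \<beta> (mult_z_power n) N"
  shows "preserves N (\<lambda>m. (\<beta> (m + int (k * n)) / \<beta> m)\<^sup>2)"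
    and "preserves N (\<lambda>m. (\<beta> m / \<beta> (m - int (k * n)))\<^sup>2)"
  using reducing_invariant_powers[OF assms, of _ k]
  unfolding preserves_def backward_shift_mult_z_power[symmetric] mult_z_power_backward_shift[symmetric]
  by blast+

lemma reducing_coordinate_periodic:
  assumes N: "reducing_subspace \<beta> (mult_z_power n) N" and i: "coordinate_vector i \<in> N"
    and j: "i mod int n = j mod int n"
  shows "coordinate_vector j \<in> N"
proof -
  have up: "coordinate_vector (i + int (k * n)) \<in> N" for k
    using reducing_invariant_powers(1)[OF N i, of k] by (simp add: mult_z_power_coordinate_vector)
  have down: "coordinate_vector (i - int (k * n)) \<in> N" for k
  proof -
    define c where "c = complex_of_real ((\<beta> i / \<beta> (i - int (k * n)))\<^sup>2)"
    have "c \<noteq> 0"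
      using pos[of i] pos[of "i - int (k * n)"] by (simp add: c_def)
    have "(\<lambda>m. c * coordinate_vector (i - int (k * n)) m) \<in> N"
      using reducing_invariant_powers(2)[OF N i, of k]
      unfolding backward_shift_coordinate_vector c_def .
    then have "(\<lambda>m. inverse c * (c * coordinate_vector (i - int (k * n)) m)) \<in> N"
      using N by (auto simp: reducing_subspace_def L2_closed_subspace_def)
    then show ?thesis using \<open>c \<noteq> 0\<close> by (simp flip: mult.assoc)
  qed
  obtain t where t: "j = i + int n * t"
    using j by (metis mod_eqE)
  show ?thesis
  proof (cases "t \<ge> 0")
    case True
    then show ?thesis using up[of "nat t"] t by (simp add: mult.commute)
  next
    case False
    then show ?thesis using down[of "nat (- t)"] t by (simp add: mult.commute)
  qed
qed

end

section \<open>Separation of coordinates and the count\<close>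

lemma weight_ratio_as_product:
  assumes "\<And>m. \<beta> m > 0"
  shows "\<beta> (m + int d) / \<beta> m = (\<Prod>t<d. shift_weight \<beta> (m + int t))"
proof (induction d)
  case 0
  then show ?case using assms[of m] by simp
next
  case (Suc d)
  have "\<beta> (m + int d) \<noteq> 0" using assms[of "m + int d"] by simp
  then have "\<beta> (m + int (Suc d)) / \<beta> m = \<beta> (m + int d) / \<beta> m * shift_weight \<beta> (m + int d)"
    by (simp add: shift_weight_def add_ac)
  then show ?case using Suc by simp
qed

lemma weight_ratio_tendsto:
  assumes pos: "\<And>m. \<beta> m > 0"
    and shift: "\<And>t. filterlim (\<lambda>m. m + int t) F F"
    and lim: "(shift_weight \<beta> \<longlongrightarrow> c) F"
  shows "((\<lambda>m. \<beta> (m + int d) / \<beta> m) \<longlongrightarrow> c ^ d) F"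
proof -
  have "((\<lambda>m. \<beta> (m + int d) / \<beta> m) \<longlongrightarrow> (\<Prod>t<d. c)) F"
    unfolding weight_ratio_as_product[where \<beta> = \<beta>, OF pos]
    by (intro tendsto_prod filterlim_compose[OF lim] shift)
  then show ?thesis by simp
qed

lemma filterlim_arith_progression:
  fixes i :: int
  assumes "n > 0"
  shows "filterlim (\<lambda>k. i + int (k * n)) at_top sequentially"
    and "filterlim (\<lambda>k. i - int (k * n)) at_bot sequentially"
proof -
  have le: "int k \<le> int (k * n)" for k
    using assms by (cases n) auto
  show "filterlim (\<lambda>k. i + int (k * n)) at_top sequentially"
    unfolding filterlim_at_top
  proof
    fix Z :: int
    show "eventually (\<lambda>k. Z \<le> i + int (k * n)) sequentially"
      using eventually_ge_at_top[of "nat (Z - i)"]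
    proof eventually_elim
      case (elim k) then show ?case using le[of k] by linarith
    qed
  qed
  show "filterlim (\<lambda>k. i - int (k * n)) at_bot sequentially"
    unfolding filterlim_at_bot
  proof
    fix Z :: int
    show "eventually (\<lambda>k. i - int (k * n) \<le> Z) sequentially"
      using eventually_ge_at_top[of "nat (i - Z)"]
    proof eventually_elim
      case (elim k) then show ?case using le[of k] by linarith
    qed
  qed
qed

lemma filterlim_int_shift:
  "filterlim (\<lambda>m::int. m + c) at_top at_top" "filterlim (\<lambda>m::int. m + c) at_bot at_bot"
proof -
  show "filterlim (\<lambda>m::int. m + c) at_top at_top"
    unfolding filterlim_at_top
  proof
    fix Z show "eventually (\<lambda>m. Z \<le> m + c) at_top"
      using eventually_ge_at_top[of "Z - c"] by eventually_elim linarith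
  qed
  show "filterlim (\<lambda>m::int. m + c) at_bot at_bot"
    unfolding filterlim_at_bot
  proof
    fix Z show "eventually (\<lambda>m. m + c \<le> Z) at_bot"
      using eventually_le_at_bot[of "Z - c"] by eventually_elim linarith
  qed
qed

text \<open>If the ratios agree at \<open>i < j\<close>, then \<open>\<beta>(m + (j - i)) / \<beta>(m)\<close> is constant on the progression of
  step \<open>n\<close> through \<open>i\<close>, which contradicts its two different limits \<open>1\<close> and \<open>r^(j - i)\<close> at the ends.
  Both the forward and the backward ratios are needed to reach both ends.\<close>

lemma ratios_separate_coordinates:
  assumes pos: "\<And>m. \<beta> m > 0" and n: "n > 0" and r: "r < 1" "0 < r"
    and bot: "(shift_weight \<beta> \<longlongrightarrow> r) at_bot" and top: "(shift_weight \<beta> \<longlongrightarrow> 1) at_top"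
    and up: "\<And>k. \<beta> (i + int (k * n)) / \<beta> i = \<beta> (j + int (k * n)) / \<beta> j"
    and down: "\<And>k. \<beta> i / \<beta> (i - int (k * n)) = \<beta> j / \<beta> (j - int (k * n))"
  shows "i = j"
proof -
  have less_False: False
    if "i < j"
      and up: "\<And>k. \<beta> (i + int (k * n)) / \<beta> i = \<beta> (j + int (k * n)) / \<beta> j"
      and down: "\<And>k. \<beta> i / \<beta> (i - int (k * n)) = \<beta> j / \<beta> (j - int (k * n))"
    for i j
  proof -
    define d where "d = nat (j - i)"
    have d: "d > 0" "j = i + int d" using that(1) by (auto simp: d_def)
    define g where "g m = \<beta> (m + int d) / \<beta> m" for m
    have nz: "\<beta> m \<noteq> 0" for m using pos[of m] by simp
    have "g (i + int (k * n)) = g i" for k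
      using up[of k] by (simp add: g_def d(2) field_simps nz add_ac)
    moreover have "(\<lambda>k. g (i + int (k * n))) \<longlonglongrightarrow> 1 ^ d"
      unfolding g_def
      by (rule filterlim_compose[OF weight_ratio_tendsto[OF pos filterlim_int_shift(1) top]
            filterlim_arith_progression(1)[OF n]])
    ultimately have "g i = 1" by (simp add: LIMSEQ_const_iff)
    have "g (i - int (k * n)) = g i" for k
      using down[of k] by (simp add: g_def d(2) field_simps nz)
    moreover have "(\<lambda>k. g (i - int (k * n))) \<longlonglongrightarrow> r ^ d"
      unfolding g_def
      by (rule filterlim_compose[OF weight_ratio_tendsto[OF pos filterlim_int_shift(2) bot]
            filterlim_arith_progression(2)[OF n]])
    ultimately have "g i = r ^ d" by (simp add: LIMSEQ_const_iff)
    with \<open>g i = 1\<close> power_Suc_less_one[of r "d - 1"] r d(1) show False by simp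
  qed
  show ?thesis
    using less_False[of i j] less_False[of j i] up down by (cases i j rule: linorder_cases) metis+
qed

lemma (in decreasing_weight) reducing_imp_residue_subspace:
  assumes n: "n > 0" and r: "0 < r" "r < 1"
    and bot: "(shift_weight \<beta> \<longlongrightarrow> r) at_bot" and top: "(shift_weight \<beta> \<longlongrightarrow> 1) at_top"
    and N: "reducing_subspace \<beta> (mult_z_power n) N"
  shows "N = residue_subspace n {i \<in> {0..<int n}. coordinate_vector i \<in> N}"
proof -
  have cl: "L2_closed_subspace \<beta> N" and NL: "N \<subseteq> L2 \<beta>"
    using N by (auto simp: reducing_subspace_def L2_closed_subspace_def)
  \<comment> \<open>One sequence of multipliers carrying the forward ratios at even and the backward ratios at odd
    positions.\<close>
  define a where "a l m = (if even l then (\<beta> (m + int (l div 2 * n)) / \<beta> m)\<^sup>2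
      else (\<beta> m / \<beta> (m - int (l div 2 * n)))\<^sup>2)" for l m
  have pres: "preserves N (a l)" for l
    unfolding a_def using reducing_preserves_ratios[OF N, of "l div 2"] by (cases "even l") auto
  have range: "0 < a l m \<and> a l m \<le> 1" for l m
    using ratio_bounds[of m "l div 2 * n"] ratio_bounds[of "m - int (l div 2 * n)" "l div 2 * n"]
    by (auto simp: a_def)
  have sep: "\<exists>l. a l m \<noteq> a l i" if "m \<noteq> i" for m i
  proof (rule ccontr)
    assume "\<not> (\<exists>l. a l m \<noteq> a l i)"
    then have "a (2 * k) m = a (2 * k) i" "a (2 * k + 1) m = a (2 * k + 1) i" for k
      by blast+
    then have sq: "(\<beta> (m + int (k * n)) / \<beta> m)\<^sup>2 = (\<beta> (i + int (k * n)) / \<beta> i)\<^sup>2"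
      "(\<beta> m / \<beta> (m - int (k * n)))\<^sup>2 = (\<beta> i / \<beta> (i - int (k * n)))\<^sup>2" for k
      by (simp_all add: a_def)
    have nonneg: "0 \<le> \<beta> x / \<beta> y" for x y
      by (simp add: less_imp_le[OF pos])
    have "\<beta> (m + int (k * n)) / \<beta> m = \<beta> (i + int (k * n)) / \<beta> i"
      "\<beta> m / \<beta> (m - int (k * n)) = \<beta> i / \<beta> (i - int (k * n))" for k
      by (rule power2_eq_imp_eq[OF _ nonneg nonneg], rule sq)+
    then have "m = i"
      by (rule ratios_separate_coordinates[OF pos n r(2,1) bot top])
    with that show False by simp
  qed
  have coord: "coordinate_vector i \<in> N" if "f \<in> N" "f i \<noteq> 0" for f i
  proof -
    have "(\<lambda>m. f i * coordinate_vector i m) \<in> N"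
      by (rule coordinate_projection_mem[OF pos cl pres range sep that(1)])
    then have "(\<lambda>m. inverse (f i) * (f i * coordinate_vector i m)) \<in> N"
      using cl by (auto simp: L2_closed_subspace_def)
    then show ?thesis using that(2) by (simp flip: mult.assoc)
  qed
  have periodic: "coordinate_vector (m mod int n) \<in> N \<longleftrightarrow> coordinate_vector m \<in> N" for m
    using reducing_coordinate_periodic[OF N, of m "m mod int n"]
      reducing_coordinate_periodic[OF N, of "m mod int n" m] by auto
  show ?thesis
  proof (intro subset_antisym subsetI)
    fix f assume "f \<in> N"
    then show "f \<in> residue_subspace n {i \<in> {0..<int n}. coordinate_vector i \<in> N}"
      using NL coord[of f] n by (auto simp: residue_subspace_def periodic)
  next
    fix f assume "f \<in> residue_subspace n {i \<in> {0..<int n}. coordinate_vector i \<in> N}"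
    then have "f \<in> L2 \<beta>" and "\<And>i. f i \<noteq> 0 \<Longrightarrow> coordinate_vector i \<in> N"
      by (auto simp: residue_subspace_def periodic)
    then show "f \<in> N"
      by (rule closed_subspace_mem_by_coordinates[OF cl])
  qed
qed

theorem theorem16:
  fixes \<beta> :: "int \<Rightarrow> real" and r :: real and n :: nat
  assumes "\<And>m. \<beta> m > 0"
    and "bdd_above (range (shift_weight \<beta>))"
    and "0 < r" and "r < 1"
    and "monotonic_A_shift r \<beta>"
    and "n \<ge> 2"
  shows "card {N. reducing_subspace \<beta> (mult_z_power n) N} = 2 ^ n"
proof -
  have mono1: "shift_weight \<beta> m \<le> shift_weight \<beta> (m + 1)" for m
    using assms(5) by (auto simp: monotonic_A_shift_def)
  have bot: "(shift_weight \<beta> \<longlongrightarrow> r) at_bot" and top: "(shift_weight \<beta> \<longlongrightarrow> 1) at_top"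
    using assms(5) by (auto simp: monotonic_A_shift_def)
  have mono: "shift_weight \<beta> m \<le> shift_weight \<beta> k" if "m \<le> k" for m k
    using that by (induction k rule: int_ge_induct) (auto intro: order_trans mono1)
  have "shift_weight \<beta> m \<le> 1" for m
  proof (rule tendsto_lowerbound[OF top])
    show "eventually (\<lambda>k. shift_weight \<beta> m \<le> shift_weight \<beta> k) at_top"
      using eventually_ge_at_top[of m] by eventually_elim (rule mono)
  qed simp
  then have "\<beta> (m + 1) \<le> \<beta> m" for m
    unfolding shift_weight_def pos_divide_le_eq[OF assms(1)] by simp
  then interpret decreasing_weight \<beta>
    using assms(1) by unfold_locales
  have "{N. reducing_subspace \<beta> (mult_z_power n) N} = residue_subspace n ` Pow {0..<int n}"
  proof (intro subset_antisym subsetI)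
    fix N assume "N \<in> {N. reducing_subspace \<beta> (mult_z_power n) N}"
    then have "N = residue_subspace n {i \<in> {0..<int n}. coordinate_vector i \<in> N}"
      using assms(3,4,6) bot top by (intro reducing_imp_residue_subspace) auto
    then show "N \<in> residue_subspace n ` Pow {0..<int n}" by blast
  qed (auto intro: residue_subspace_reducing)
  then show ?thesis
    by (simp add: card_image[OF inj_on_residue_subspace] card_Pow)
qed

end
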